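(* Let $a\ge2$ be an integer and let $\mu$ be a Borel probability measure on $[0,1]$ which is $T_a$-ergodic and of intermediate dimension. Let $n\in\mathbb{N}$ be such that for every $f\in\mathrm{diff}(\mathbb{R})$ and every set $E\subseteq\mathbb{R}$ with $(f\mu)|_E\sim\mu|_E$ one has $f'(x)\in\{\pm a^{k/n}:k\in\mathbb{Z}\}$ for $\mu$-a.e. $x\in f^{-1}E$ (such an $n$ exists). Then every piecewise analytic map of $[0,1]$ which preserves $\mu$ is piecewise linear on an open set $U$ containing the support of $\mu$, and on $U$ has slopes of the form $\pm a^{k/n}$, $k\in\mathbb{Z}$.
   Context: $T_a:[0,1]\to[0,1]$ is $T_a(x)=ax\bmod 1$. $T_a$-ergodic means $T_a$-invariant and ergodic for $T_a$. For a map $f$, $f\mu(A)=\mu(f^{-1}A)$, and $f$ preserves $\mu$ if $f\mu=\mu$; $\mu|_E(A)=\mu(A\cap E)$; $\sim$ denotes equivalence of measures. $\mathrm{diff}(\mathbb{R})$ is the set of ($C^1$) diffeomorphisms of $\mathbb{R}$. The support of $\mu$ is the complement of the union of all open sets of $\mu$-measure zero. $\mu$ has intermediate dimension if the local dimension $D(\mu,x)=\lim_{r\to0}\log\mu(B_r(x))/\log r$, where $B_r(x)$ is the ball of radius $r$ around $x$, exists and satisfies $0<D(\mu,x)<1$ for $\mu$-a.e. $x$. Piecewise analytic and piecewise linear are used in the usual sense: the domain is divided into intervals on each of which the map is real-analytic, respectively of the form $x\mapsto ux+v$, $u$ being the slope.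
   Formalization: U (open in [0,1]) need not contain points of the support that are both non-analyticity points of the map in (0,1) and endpoints of gaps of the support; as stated the claim fails, e.g. for the Cantor measure and a map equal to x off (1/3,2/3) and quadratic on it. *)

theory Defs
  imports "HOL-Probability.Probability_Measure"
begin

text \<open>
  A Borel probability measure on $[0,1]$ is a Borel probability measure on the real line giving
  full measure to \<open>{0..1}\<close>, so that its images under diffeomorphisms of the line make sense.
  A map of $[0,1]$ is a function on \<open>real\<close> whose values outside \<open>{0..1}\<close> are never used.
\<close>

definition prob_on_unit_interval :: "real measure \<Rightarrow> bool" where
  "prob_on_unit_interval \<mu> \<longleftrightarrow> sets \<mu> = sets borel \<and> prob_space \<mu> \<and> emeasure \<mu> {0..1} = 1"

definition preserves :: "(real \<Rightarrow> real) \<Rightarrow> real measure \<Rightarrow> bool" where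
  "preserves g \<mu> \<longleftrightarrow>
     g \<in> borel_measurable (restrict_space \<mu> {0..1}) \<and>
     distr (restrict_space \<mu> {0..1}) borel g = \<mu>"

definition ergodic_for :: "(real \<Rightarrow> real) \<Rightarrow> real measure \<Rightarrow> bool" where
  "ergodic_for T \<mu> \<longleftrightarrow>
     preserves T \<mu> \<and>
     (\<forall>A\<in>sets borel. A \<subseteq> {0..1} \<and> {x\<in>{0..1}. T x \<in> A} = A \<longrightarrow> measure \<mu> A \<in> {0, 1})"

definition times_map :: "nat \<Rightarrow> real \<Rightarrow> real" where
  "times_map a x = frac (real a * x)"

text \<open>
  Points with a null neighbourhood, where the true quotient is infinite for small \<open>r\<close> but
  \<open>ln 0 = 0\<close> makes it vanish, form a null set and are excluded by \<open>0 < D\<close> below anyway.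
\<close>

definition has_local_dimension :: "real measure \<Rightarrow> real \<Rightarrow> real \<Rightarrow> bool" where
  "has_local_dimension \<mu> x D \<longleftrightarrow>
     ((\<lambda>r. ln (measure \<mu> (ball x r)) / ln r) \<longlongrightarrow> D) (at_right 0)"

definition intermediate_dimension :: "real measure \<Rightarrow> bool" where
  "intermediate_dimension \<mu> \<longleftrightarrow> (AE x in \<mu>. \<exists>D. has_local_dimension \<mu> x D \<and> 0 < D \<and> D < 1)"

definition support :: "real measure \<Rightarrow> real set" where
  "support \<mu> = - \<Union>{V. open V \<and> emeasure \<mu> V = 0}"

definition meas_restrict :: "real measure \<Rightarrow> real set \<Rightarrow> real measure" where
  "meas_restrict \<mu> E = density \<mu> (indicator E)"

lemma emeasure_meas_restrict:
  "E \<in> sets \<mu> \<Longrightarrow> A \<in> sets \<mu> \<Longrightarrow> emeasure (meas_restrict \<mu> E) A = emeasure \<mu> (A \<inter> E)"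
  by (simp add: meas_restrict_def emeasure_density flip: indicator_inter_arith)
     (simp add: Int_commute)

definition equiv_measures :: "real measure \<Rightarrow> real measure \<Rightarrow> bool" where
  "equiv_measures M N \<longleftrightarrow> absolutely_continuous M N \<and> absolutely_continuous N M"

definition diffR :: "(real \<Rightarrow> real) set" where
  "diffR = {f. bij f \<and> f C1_differentiable_on UNIV \<and> inv f C1_differentiable_on UNIV}"

definition slopes :: "nat \<Rightarrow> nat \<Rightarrow> real set" where
  "slopes a n = {\<epsilon> * real a powr (real_of_int k / real n) | \<epsilon> k. \<epsilon> \<in> {1, -1}}"

text \<open>
  Intervals may be open, half-open, closed or a single point; single points are needed
  for \<open>times_map a\<close> itself to be piecewise linear on \<open>{0..1}\<close>, as it takes the value 0 at 1.
\<close>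

definition interval_division :: "real set \<Rightarrow> real set set \<Rightarrow> bool" where
  "interval_division S P \<longleftrightarrow> finite P \<and> partition_on S P \<and> (\<forall>I\<in>P. is_interval I)"

text \<open>At an endpoint of \<open>I\<close> belonging to \<open>I\<close>, the power series represents \<open>g\<close> on one side only.\<close>

definition real_analytic_on :: "(real \<Rightarrow> real) \<Rightarrow> real set \<Rightarrow> bool" where
  "real_analytic_on g I \<longleftrightarrow>
     (\<forall>x\<in>I. \<exists>r>0. \<exists>c. \<forall>y\<in>I. \<bar>y - x\<bar> < r \<longrightarrow> (\<lambda>m. c m * (y - x) ^ m) sums g y)"

definition piecewise_analytic_on :: "(real \<Rightarrow> real) \<Rightarrow> real set \<Rightarrow> bool" where
  "piecewise_analytic_on g S \<longleftrightarrow> (\<exists>P. interval_division S P \<and> (\<forall>I\<in>P. real_analytic_on g I))"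

definition piecewise_linear_with_slopes :: "(real \<Rightarrow> real) \<Rightarrow> real set \<Rightarrow> real set \<Rightarrow> bool" where
  "piecewise_linear_with_slopes g S \<Lambda> \<longleftrightarrow>
     (\<exists>P. interval_division S P \<and> (\<forall>I\<in>P. \<exists>u\<in>\<Lambda>. \<exists>v. \<forall>x\<in>I. g x = u * x + v))"

definition break_points :: "(real \<Rightarrow> real) \<Rightarrow> real set" where
  "break_points g = {x\<in>{0<..<1}. \<not> (\<exists>e>0. real_analytic_on g ({0..1} \<inter> ball x e))}"

text \<open>
  A break point of \<open>g\<close> that is an endpoint of a gap of the support (for instance 1/3 for the
  middle-third Cantor measure) cannot in general lie in an open set on which \<open>g\<close> is piecewise
  linear: on the gap, a null set, a map preserving the measure may be any analytic function.
\<close>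

definition gap_endpoints :: "real set \<Rightarrow> real set" where
  "gap_endpoints K = {x\<in>K. \<exists>e>0. {x - e<..<x} \<inter> K = {} \<or> {x<..<x + e} \<inter> K = {}}"

end

theory Submission
  imports Defs "HOL-Complex_Analysis.Cauchy_Integral_Formula"
begin

text \<open>
  Near a point where \<open>g\<close> is analytic and \<open>g' \<noteq> 0\<close>, the map \<open>g\<close> extends to a diffeomorphism \<open>f\<close> of
  the line. Since \<open>g\<close> preserves \<open>\<mu>\<close>, the local image of \<open>\<mu>\<close> under \<open>f\<close> is dominated by \<open>\<mu>\<close>, and it is
  equivalent to \<open>\<mu>\<close> on the set where its density is nonzero; hence \<open>g'\<close> is zero or
  one of the countably many slopes almost everywhere. As \<open>\<mu>\<close> has no atoms, some level set of \<open>g'\<close>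
  is uncountable on each piece of positive measure, so \<open>g'\<close> is constant there by analyticity; the
  constant is nonzero, for otherwise \<open>g\<close> would create an atom.
  A point of the support on the boundary of a piece either has pieces of positive measure on both
  sides, or is an endpoint of a gap; in the latter case, unless it is a break point, \<open>g\<close> is
  analytic around it and the same argument applies to a neighbourhood of it.
\<close>

section \<open>Real-analytic functions on open subsets of the line\<close>

lemma real_analytic_on_subset:
  "real_analytic_on g S \<Longrightarrow> T \<subseteq> S \<Longrightarrow> real_analytic_on g T"
  unfolding real_analytic_on_def by (meson subsetD)

text \<open>In an open set the radius can be shrunk until every increment stays in \<open>S\<close>,
  so the possibly one-sided expansion of the definition becomes an ordinary power series in
  \<open>h\<close>.\<close>

lemma real_analytic_on_openE:
  assumes "real_analytic_on g S" "open S" "x \<in> S"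
  obtains r c where "r > 0" "ball x r \<subseteq> S"
    "\<And>h. \<bar>h\<bar> < r \<Longrightarrow> (\<lambda>m. c m * h ^ m) sums g (x + h)"
proof -
  obtain r c where r: "r > 0"
      "\<And>y. y \<in> S \<Longrightarrow> \<bar>y - x\<bar> < r \<Longrightarrow> (\<lambda>m. c m * (y - x) ^ m) sums g y"
    using assms unfolding real_analytic_on_def by blast
  obtain e where e: "e > 0" "ball x e \<subseteq> S"
    using assms(2,3) open_contains_ball by blast
  show thesis
  proof (rule that)
    show "min r e > 0" "ball x (min r e) \<subseteq> S"
      using r(1) e by auto
    fix h :: real assume h: "\<bar>h\<bar> < min r e"
    then have "x + h \<in> S"
      using e(2) by (auto simp: dist_real_def subset_iff)
    with h show "(\<lambda>m. c m * h ^ m) sums g (x + h)"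
      using r(2)[of "x + h"] by simp
  qed
qed

lemma real_analytic_onI:
  assumes "\<And>x. x \<in> S \<Longrightarrow> \<exists>r>0. \<exists>c. \<forall>h. \<bar>h\<bar> < r \<longrightarrow> (\<lambda>m. c m * h ^ m) sums g (x + h)"
  shows "real_analytic_on g S"
  unfolding real_analytic_on_def
proof
  fix x assume "x \<in> S"
  then obtain r c where r: "r > 0" "\<And>h. \<bar>h\<bar> < r \<Longrightarrow> (\<lambda>m. c m * h ^ m) sums g (x + h)"
    using assms by blast
  then have "\<forall>y\<in>S. \<bar>y - x\<bar> < r \<longrightarrow> (\<lambda>m. c m * (y - x) ^ m) sums g y"
    by (metis add_diff_cancel_left' diff_add_cancel add.commute)
  with r(1) show "\<exists>r>0. \<exists>c. \<forall>y\<in>S. \<bar>y - x\<bar> < r \<longrightarrow> (\<lambda>m. c m * (y - x) ^ m) sums g y"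
    by blast
qed

lemma powser_has_derivative:
  fixes g :: "real \<Rightarrow> real"
  assumes sums: "\<And>h. \<bar>h\<bar> < r \<Longrightarrow> (\<lambda>m. c m * h ^ m) sums g (x + h)" and h: "\<bar>h\<bar> < r"
  shows "(g has_real_derivative (\<Sum>m. diffs c m * h ^ m)) (at (x + h))"
proof -
  have "((\<lambda>z. \<Sum>m. c m * z ^ m) has_real_derivative (\<Sum>m. diffs c m * h ^ m)) (at h)"
    using sums h by (intro termdiffs_strong'[where K = r]) (auto simp: sums_iff)
  then have "((\<lambda>z. \<Sum>m. c m * (z - x) ^ m) has_real_derivative (\<Sum>m. diffs c m * h ^ m)) (at (x + h))"
    by (subst add.commute, subst DERIV_shift) simp
  moreover have "(\<Sum>m. c m * (z - x) ^ m) = g z" if "z \<in> ball x r" for z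
    using sums[of "z - x"] that by (simp add: sums_iff dist_real_def abs_minus_commute)
  ultimately show ?thesis
    using h by (elim has_field_derivative_transform_within_open[where S = "ball x r"])
      (auto simp: dist_real_def)
qed

lemma real_analytic_on_has_derivative:
  assumes "real_analytic_on g S" "open S" "x \<in> S"
  shows "(g has_real_derivative deriv g x) (at x)"
proof -
  obtain r c where "r > 0" and "\<And>h. \<bar>h\<bar> < r \<Longrightarrow> (\<lambda>m. c m * h ^ m) sums g (x + h)"
    using real_analytic_on_openE[OF assms] by metis
  from powser_has_derivative[OF this(2), of r 0] this(1) show ?thesis
    by (simp add: DERIV_imp_deriv)
qed

lemma real_analytic_on_continuous_on:
  "real_analytic_on g S \<Longrightarrow> open S \<Longrightarrow> continuous_on S g"
  by (meson DERIV_isCont continuous_at_imp_continuous_on real_analytic_on_has_derivative)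

lemma real_analytic_on_deriv:
  assumes "real_analytic_on g S" "open S"
  shows "real_analytic_on (deriv g) S"
proof (rule real_analytic_onI)
  fix x assume "x \<in> S"
  then obtain r c where r: "r > 0" "\<And>h. \<bar>h\<bar> < r \<Longrightarrow> (\<lambda>m. c m * h ^ m) sums g (x + h)"
    using real_analytic_on_openE[OF assms] by metis
  have "(\<lambda>m. diffs c m * h ^ m) sums deriv g (x + h)" if "\<bar>h\<bar> < r" for h
  proof -
    have "summable (\<lambda>m. diffs c m * h ^ m)"
      using r(2) that by (intro termdiff_converges[where K = r]) (auto simp: sums_iff)
    with powser_has_derivative[OF r(2) that] show ?thesis
      by (simp add: DERIV_imp_deriv summable_sums)
  qed
  with r(1) show "\<exists>r>0. \<exists>c. \<forall>h. \<bar>h\<bar> < r \<longrightarrow> (\<lambda>m. c m * h ^ m) sums deriv g (x + h)"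
    by blast
qed

lemma real_analytic_on_diff_const:
  assumes "real_analytic_on g S" "open S"
  shows "real_analytic_on (\<lambda>x. g x - s) S"
proof (rule real_analytic_onI)
  fix x assume "x \<in> S"
  then obtain r c where r: "r > 0" "\<And>h. \<bar>h\<bar> < r \<Longrightarrow> (\<lambda>m. c m * h ^ m) sums g (x + h)"
    using real_analytic_on_openE[OF assms] by metis
  have "(\<lambda>m. (c m - (if m = 0 then s else 0)) * h ^ m) sums (g (x + h) - s)" if "\<bar>h\<bar> < r" for h
  proof -
    have "(\<lambda>m. (if m = 0 then s else 0) * h ^ m) sums (s * h ^ 0)"
      using sums_single[of 0 "\<lambda>m. s * h ^ m"] by (simp add: if_distrib[of "\<lambda>t. t * _"] cong: if_cong)
    from sums_diff[OF r(2)[OF that] this] show ?thesis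
      by (simp add: left_diff_distrib)
  qed
  with r(1) show "\<exists>r>0. \<exists>c. \<forall>h. \<bar>h\<bar> < r \<longrightarrow> (\<lambda>m. c m * h ^ m) sums (g (x + h) - s)"
    by (intro exI[of _ r] conjI exI[of _ "\<lambda>m. c m - (if m = 0 then s else 0)"]) auto
qed

text \<open>If all coefficients at \<open>x\<close> vanish, so does \<open>g\<close> near
  \<open>x\<close>; otherwise a zero at \<open>x\<close> has finite order and is isolated, and a
  nonzero value at \<open>x\<close> persists by continuity.\<close>

lemma real_analytic_on_zero_dichotomy:
  assumes "real_analytic_on g S" "open S" "x \<in> S"
  shows "(\<forall>\<^sub>F y in nhds x. g y = 0) \<or> (\<forall>\<^sub>F y in at x. g y \<noteq> 0)"
proof -
  obtain r c where r: "r > 0" "\<And>h. \<bar>h\<bar> < r \<Longrightarrow> (\<lambda>m. c m * h ^ m) sums g (x + h)"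
    using real_analytic_on_openE[OF assms] by metis
  show ?thesis
  proof (cases "\<forall>m. c m = 0")
    case True
    have "g y = 0" if "dist y x < r" for y
      using r(2)[of "y - x"] that True by (auto simp: dist_real_def intro: sums_unique2 sums_zero)
    then show ?thesis
      using r(1) eventually_nhds_metric by blast
  next
    case False
    then obtain m where m: "c m \<noteq> 0" by blast
    show ?thesis
    proof (cases "g x = 0")
      case True
      \<comment> \<open>\<open>powser_0_nonzero\<close> asks for a nonzero coefficient of positive
        index; \<open>g x = 0\<close> rules out index 0.\<close>
      have "c 0 = g x"
        using r(2)[of 0] r(1) sums_unique2[OF powser_sums_zero] by simp
      with m True have "m > 0" by (metis gr0I)
      obtain s where "s > 0" "\<And>z. z \<in> cball x s - {x} \<Longrightarrow> g z \<noteq> 0"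
      proof (rule powser_0_nonzero[of r x c g m])
        fix y assume "norm (y - x) < r"
        with r(2)[of "y - x"] show "(\<lambda>n. c n * (y - x) ^ n) sums g y" by simp
      qed (use r True m \<open>m > 0\<close> in auto)
      then have "\<forall>\<^sub>F y in at x. g y \<noteq> 0"
        unfolding eventually_at by (intro exI[of _ s]) (auto simp: dist_commute)
      then show ?thesis ..
    next
      case False
      have "(g \<longlongrightarrow> g x) (at x)"
        using real_analytic_on_has_derivative[OF assms] DERIV_isCont isCont_def by blast
      from tendsto_imp_eventually_ne[OF this False] show ?thesis ..
    qed
  qed
qed

text \<open>Identity theorem with uncountability in place of an accumulation point. The points near
  which \<open>g\<close> vanishes and the points with a zero-free punctured neighbourhood form
  disjoint open sets covering \<open>S\<close>, so one of them is empty; if all zeros are isolated,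
  there are only countably many.\<close>

lemma real_analytic_on_eq_zero:
  assumes an: "real_analytic_on g S" "open S" and "connected S"
    and unc: "uncountable {x\<in>S. g x = 0}" and "x \<in> S"
  shows "g x = 0"
proof -
  define A where "A = {x\<in>S. \<forall>\<^sub>F y in nhds x. g y = 0}"
  define B where "B = {x\<in>S. \<forall>\<^sub>F y in at x. g y \<noteq> 0}"
  have "A \<union> B = S"
    using real_analytic_on_zero_dichotomy[OF an] by (auto simp: A_def B_def)
  have "A \<inter> B = {}"
  proof -
    have False if "\<forall>\<^sub>F y in nhds x. g y = 0" "\<forall>\<^sub>F y in at x. g y \<noteq> 0" for x
    proof -
      have "\<forall>\<^sub>F y in at x. g y = 0"
        using that(1) by (simp add: eventually_at_filter eventually_mono)
      with that(2) have "\<forall>\<^sub>F y in at x. False" by eventually_elim simp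
      then show False by simp
    qed
    then show ?thesis by (auto simp: A_def B_def)
  qed
  have "open A"
  proof -
    have "A = S \<inter> {x. \<forall>\<^sub>F y in nhds x. g y = 0}" by (auto simp: A_def)
    moreover have "open {x. \<forall>\<^sub>F y in nhds x. g y = 0}"
      by (subst open_subopen) (auto simp: eventually_nhds)
    ultimately show ?thesis using \<open>open S\<close> by auto
  qed
  have "open B"
  proof (subst open_subopen, intro ballI)
    fix x assume "x \<in> B"
    then obtain T where T: "open T" "x \<in> T" "\<And>y. y \<in> T \<Longrightarrow> y \<noteq> x \<Longrightarrow> g y \<noteq> 0" "x \<in> S"
      unfolding B_def eventually_at_topological by blast
    have "T \<inter> S \<subseteq> B"
    proof
      fix y assume y: "y \<in> T \<inter> S"
      show "y \<in> B"
      proof (cases "y = x")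
        case False
        then have "y \<notin> A" using T y by (auto simp: A_def dest: eventually_nhds_x_imp_x)
        with y \<open>A \<union> B = S\<close> show ?thesis by auto
      qed (use \<open>x \<in> B\<close> in simp)
    qed
    with T \<open>open S\<close> show "\<exists>T. open T \<and> x \<in> T \<and> T \<subseteq> B" by (intro exI[of _ "T \<inter> S"]) auto
  qed
  consider "A = {}" | "B = {}"
    using connectedD[OF \<open>connected S\<close> \<open>open A\<close> \<open>open B\<close>] \<open>A \<union> B = S\<close> \<open>A \<inter> B = {}\<close> by blast
  then show ?thesis
  proof cases
    case 1
    then have "B = S" using \<open>A \<union> B = S\<close> by simp
    then have "{x\<in>S. g x = 0} sparse_in S"
      by (auto simp: sparse_in_open[OF \<open>open S\<close>] B_def islimpt_iff_eventually elim: eventually_mono)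
    then have "countable (S \<inter> {x\<in>S. g x = 0})"
      by (rule sparse_imp_countable[OF \<open>open S\<close>])
    moreover have "S \<inter> {x\<in>S. g x = 0} = {x\<in>S. g x = 0}" by auto
    ultimately show ?thesis using unc by simp
  next
    case 2
    with \<open>A \<union> B = S\<close> \<open>x \<in> S\<close> show ?thesis by (auto simp: A_def dest: eventually_nhds_x_imp_x)
  qed
qed

text \<open>The identity theorem applied to \<open>deriv g\<close> minus \<open>s\<close> makes the
  derivative constant on the interval \<open>S\<close>.\<close>

lemma real_analytic_on_affine:
  assumes an: "real_analytic_on g S" "open S" and "connected S"
    and unc: "uncountable {x\<in>S. deriv g x = s}"
  obtains v where "\<And>x. x \<in> S \<Longrightarrow> g x = s * x + v"
proof -
  have d: "deriv g x = s" if "x \<in> S" for x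
    using real_analytic_on_eq_zero[OF real_analytic_on_diff_const[OF real_analytic_on_deriv[OF an] \<open>open S\<close>, of s]]
      assms that by simp
  have "((\<lambda>x. g x - s * x) has_real_derivative 0) (at x within S)" if "x \<in> S" for x
  proof -
    have "((\<lambda>x. g x - s * x) has_real_derivative deriv g x - s) (at x)"
      using real_analytic_on_has_derivative[OF an that] by (auto intro!: derivative_eq_intros)
    with d[OF that] show ?thesis by (simp add: has_field_derivative_at_within)
  qed
  moreover have "convex S" using \<open>connected S\<close> is_interval_connected_1 is_interval_convex_1 by blast
  ultimately have "\<exists>v. \<forall>x\<in>S. g x - s * x = v"
    using has_field_derivative_zero_constant[of S "\<lambda>x. g x - s * x"] by blast
  then obtain v where "\<And>x. x \<in> S \<Longrightarrow> g x - s * x = v"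
    by blast
  then show thesis by (intro that[of v]) force
qed

section \<open>Extension of local maps to diffeomorphisms of the line\<close>

text \<open>A derivative of constant sign bounded away from 0 makes \<open>F\<close> stretch
  distances by at least \<open>m\<close>. Hence \<open>F\<close> is injective, its range is
  unbounded in both directions, and its inverse is Lipschitz.\<close>

lemma diffR_of_derivative:
  fixes F d :: "real \<Rightarrow> real"
  assumes F: "\<And>x. (F has_real_derivative d x) (at x)" and d: "continuous_on UNIV d"
    and m: "m > 0" and sgn: "(\<forall>x. d x \<ge> m) \<or> (\<forall>x. d x \<le> - m)"
  shows "F \<in> diffR"
proof -
  have mvt: "\<exists>z. F t - F s = (t - s) * d z" for s t
  proof -
    consider "s < t" | "s = t" | "t < s" by linarith
    then show ?thesis
    proof cases
      case 1 then show ?thesis using MVT2[of s t F d] F by auto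
    next
      case 3 then obtain z where "F s - F t = (s - t) * d z" using MVT2[of t s F d] F by blast
      then have "F t - F s = (t - s) * d z" by (simp add: algebra_simps)
      then show ?thesis ..
    qed simp
  qed
  have exp: "m * \<bar>t - s\<bar> \<le> \<bar>F t - F s\<bar>" for s t
  proof -
    obtain z where z: "F t - F s = (t - s) * d z" using mvt by blast
    have "m \<le> \<bar>d z\<bar>" using sgn by (auto dest!: spec[of _ z])
    then show ?thesis by (simp add: z abs_mult mult.commute[of "\<bar>t - s\<bar>"] mult_right_mono)
  qed
  have "inj F"
  proof (rule injI)
    fix s t assume "F s = F t"
    with exp[of t s] m show "s = t" by (simp add: mult_le_0_iff)
  qed
  have cont: "continuous_on S F" for S
    by (meson DERIV_isCont F continuous_at_imp_continuous_on)
  have "y \<in> range F" for y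
  proof -
    \<comment> \<open>A displacement by \<open>T\<close> from 0 changes \<open>F\<close> by at least
      \<open>m * T\<close>, so \<open>y\<close> lies between the values of \<open>F\<close> at
      \<open>-T\<close> and \<open>T\<close>.\<close>
    define T where "T = \<bar>y - F 0\<bar> / m"
    have T: "T \<ge> 0" "m * T = \<bar>y - F 0\<bar>" using m by (auto simp: T_def)
    obtain z1 z2 where z: "F T - F 0 = T * d z1" "F (-T) - F 0 = - T * d z2"
      using mvt[of T 0] mvt[of "-T" 0] by auto
    have conn: "connected (range F)" using cont by (intro connected_continuous_image) auto
    show ?thesis
      using sgn
    proof
      assume "\<forall>x. d x \<ge> m"
      then have "T * d z1 \<ge> m * T" "T * d z2 \<ge> m * T"
        using T(1) by (simp_all add: mult.commute[of m] mult_left_mono)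
      then have "F (-T) \<le> y" "y \<le> F T" using z T(2) by linarith+
      then show ?thesis using connectedD_interval[OF conn, of "F (-T)" "F T" y] by auto
    next
      assume "\<forall>x. d x \<le> - m"
      then have "T * d z1 \<le> T * (-m)" "T * d z2 \<le> T * (-m)"
        using T(1) mult_left_mono by blast+
      then have "F T \<le> y" "y \<le> F (-T)" using z T(2) by (simp_all add: mult.commute)
      then show ?thesis using connectedD_interval[OF conn, of "F T" "F (-T)" y] by auto
    qed
  qed
  then have "surj F" by blast
  with \<open>inj F\<close> have "bij F" by (simp add: bij_def)
  have inv: "F (inv F y) = y" for y using \<open>surj F\<close> by (simp add: surj_f_inv_f)
  \<comment> \<open>Continuity of the inverse comes first: both its differentiability and the
    continuity of its derivative rest on it.\<close>
  have lip: "\<bar>inv F t - inv F s\<bar> \<le> \<bar>t - s\<bar> / m" for s t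
    using exp[of "inv F t" "inv F s"] m by (simp add: inv field_simps)
  have inv_cont: "isCont (inv F) y" for y
  proof -
    have "((\<lambda>t. \<bar>t - y\<bar> / m) \<longlongrightarrow> \<bar>y - y\<bar> / m) (at y)"
      by (intro tendsto_intros) (use m in simp)
    then have "((\<lambda>t. \<bar>t - y\<bar> / m) \<longlongrightarrow> 0) (at y)" by simp
    then have "((\<lambda>t. inv F t - inv F y) \<longlongrightarrow> 0) (at y)"
      by (rule Lim_null_comparison[rotated]) (simp add: lip)
    then show ?thesis by (simp add: isCont_def LIM_zero_iff)
  qed
  have d0: "d x \<noteq> 0" for x using sgn m by (auto dest!: spec[of _ x])
  have inv_deriv: "(inv F has_real_derivative inverse (d (inv F y))) (at y)" for y
    by (rule DERIV_inverse_function[of F _ _ _ "y - 1" "y + 1"]) (auto simp: F d0 inv inv_cont)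
  have "F C1_differentiable_on UNIV"
    unfolding C1_differentiable_on_def
    using F d by (auto simp: has_real_derivative_iff_has_vector_derivative)
  moreover have "inv F C1_differentiable_on UNIV"
  proof -
    have "continuous_on UNIV (inv F)" using inv_cont continuous_at_imp_continuous_on by blast
    then have "continuous_on UNIV (\<lambda>y. inverse (d (inv F y)))"
      using d d0 by (intro continuous_intros continuous_on_compose2[OF d]) auto
    with inv_deriv show ?thesis unfolding C1_differentiable_on_def
      by (intro exI[of _ "\<lambda>y. inverse (d (inv F y))"])
        (auto simp: has_real_derivative_iff_has_vector_derivative)
  qed
  ultimately show ?thesis using \<open>bij F\<close> by (simp add: diffR_def)
qed

text \<open>Outside a small interval around \<open>x\<close> the derivative is frozen at its
  boundary values. It then stays close to \<open>d x\<close> on the whole line, and a suitable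
  antiderivative is the diffeomorphism sought.\<close>

lemma local_diffR_extension:
  fixes g :: "real \<Rightarrow> real"
  assumes g: "\<And>x. x \<in> S \<Longrightarrow> (g has_real_derivative d x) (at x)"
    and d: "continuous_on S d" and "open S" "x \<in> S" "d x \<noteq> 0"
  obtains f e where "f \<in> diffR" "e > 0" "ball x e \<subseteq> S" "\<And>y. y \<in> ball x e \<Longrightarrow> f y = g y"
proof -
  \<comment> \<open>With half of the modulus of \<open>d x\<close> as tolerance, the derivative
    keeps its sign and has modulus at least \<open>m\<close>.\<close>
  define m where "m = \<bar>d x\<bar> / 2"
  have "m > 0" using assms by (simp add: m_def)
  obtain e1 where e1: "e1 > 0" "cball x e1 \<subseteq> S" using assms open_contains_cball by blast
  have "isCont d x" using d assms continuous_on_eq_continuous_at by blast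
  then obtain e2 where e2: "e2 > 0" "\<And>y. dist y x < e2 \<Longrightarrow> dist (d y) (d x) < m"
    using \<open>m > 0\<close> unfolding continuous_at_eps_delta by blast
  \<comment> \<open>Halving \<open>e2\<close> makes the strict estimate available on the closed
    ball, boundary included.\<close>
  define e where "e = min e1 (e2 / 2)"
  have e: "e > 0" "cball x e \<subseteq> S" "\<And>y. y \<in> cball x e \<Longrightarrow> \<bar>d y - d x\<bar> < m"
    using e1 e2(1) e2(2)[unfolded dist_real_def] by (auto simp: e_def dist_real_def abs_minus_commute)
  \<comment> \<open>\<open>k\<close> is the nearest-point retraction onto \<open>cball x e\<close>,
    so \<open>d\<close> composed with \<open>k\<close> is continuous on the line.\<close>
  define k where "k t = max (x - e) (min (x + e) t)" for t
  have k: "k t \<in> cball x e" for t using e(1) by (auto simp: k_def dist_real_def)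
  have k_id: "k t = t" if "t \<in> cball x e" for t using that by (auto simp: k_def dist_real_def)
  have "continuous_on UNIV k" unfolding k_def by (intro continuous_intros)
  then have dk: "continuous_on UNIV (\<lambda>t. d (k t))"
    using k e(2) by (intro continuous_on_compose2[OF d]) auto
  have "\<exists>F. \<forall>t. - \<infinity> < ereal t \<longrightarrow> ereal t < \<infinity> \<longrightarrow> (F has_vector_derivative d (k t)) (at t)"
    by (rule einterval_antiderivative) (use dk in \<open>auto simp: continuous_on_eq_continuous_at\<close>)
  then obtain F where F: "\<And>t. (F has_real_derivative d (k t)) (at t)"
    by (auto simp: has_real_derivative_iff_has_vector_derivative)
  have "((\<lambda>t. F t - g t) has_real_derivative 0) (at t within ball x e)" if "t \<in> ball x e" for t
  proof -
    have "t \<in> S" using that e by auto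
    then have "((\<lambda>t. F t - g t) has_real_derivative d (k t) - d t) (at t)"
      using F g by (intro derivative_intros) auto
    moreover have "k t = t" using that by (intro k_id) auto
    ultimately show ?thesis by (simp add: has_field_derivative_at_within)
  qed
  then have "\<exists>c. \<forall>t\<in>ball x e. F t - g t = c"
    using has_field_derivative_zero_constant[of "ball x e" "\<lambda>t. F t - g t"] convex_ball by blast
  then obtain c where c: "\<And>t. t \<in> ball x e \<Longrightarrow> F t - g t = c" by blast
  define f where "f t = F t - c" for t
  have "f \<in> diffR"
  proof (rule diffR_of_derivative[OF _ dk \<open>m > 0\<close>])
    show "(f has_real_derivative d (k t)) (at t)" for t
      unfolding f_def using F by (auto intro!: derivative_eq_intros)
    have "\<bar>d (k t) - d x\<bar> < m" for t using k e(3) by blast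
    then show "(\<forall>t. m \<le> d (k t)) \<or> (\<forall>t. d (k t) \<le> - m)"
      using \<open>d x \<noteq> 0\<close> unfolding m_def by (smt (verit) field_sum_of_halves)
  qed
  then show thesis
    using e c by (intro that[of f e]) (force simp: f_def)+
qed

section \<open>Invariant measures, admissible derivatives and atoms\<close>

lemma preserves_emeasure:
  assumes "preserves g \<mu>" "sets \<mu> = sets borel" "A \<in> sets borel"
  shows "g -` A \<inter> {0..1} \<in> sets \<mu>" "emeasure \<mu> (g -` A \<inter> {0..1}) = emeasure \<mu> A"
proof -
  have space: "space \<mu> = UNIV" using sets_eq_imp_space_eq[OF assms(2)] by simp
  have g: "g \<in> borel_measurable (restrict_space \<mu> {0..1})"
    and d: "distr (restrict_space \<mu> {0..1}) borel g = \<mu>"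
    using assms(1) by (auto simp: preserves_def)
  have *: "g -` A \<inter> {0..1} \<in> sets (restrict_space \<mu> {0..1})"
    using measurable_sets[OF g assms(3)] by (simp add: space_restrict_space space)
  then show "g -` A \<inter> {0..1} \<in> sets \<mu>"
    by (simp add: sets_restrict_space_iff space assms(2))
  have "emeasure \<mu> A = emeasure (distr (restrict_space \<mu> {0..1}) borel g) A" by (simp add: d)
  also have "\<dots> = emeasure (restrict_space \<mu> {0..1}) (g -` A \<inter> {0..1})"
    by (subst emeasure_distr[OF g assms(3)]) (simp add: space_restrict_space space)
  also have "\<dots> = emeasure \<mu> (g -` A \<inter> {0..1})"
    by (rule emeasure_restrict_space) (auto simp: assms(2) space)
  finally show "emeasure \<mu> (g -` A \<inter> {0..1}) = emeasure \<mu> A" ..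
qed

text \<open>On \<open>J\<close> the map \<open>f\<close> agrees with \<open>g\<close>, so the image
  under \<open>f\<close> of \<mu> restricted to \<open>J\<close> is dominated by the image of \<mu>
  under \<open>g\<close>, which is \<mu> itself. It therefore has a density, and removing the zeros
  of the density from the image of \<open>J\<close> leaves a set on which the domination goes both
  ways.\<close>

lemma transported_equivalence:
  assumes \<mu>: "sets \<mu> = sets borel" "finite_measure \<mu>" and g: "preserves g \<mu>"
    and f: "f \<in> borel_measurable borel" "inj f"
    and J: "J \<in> sets borel" "f ` J \<in> sets borel" "J \<subseteq> {0..1}" "\<And>x. x \<in> J \<Longrightarrow> f x = g x"
  obtains E where "E \<in> sets borel"
    "equiv_measures (meas_restrict (distr \<mu> borel f) E) (meas_restrict \<mu> E)"
    "AE x in \<mu>. x \<in> J \<longrightarrow> f x \<in> E"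
proof -
  interpret finite_measure \<mu> by fact
  have space: "space \<mu> = UNIV" using sets_eq_imp_space_eq[OF \<mu>(1)] by simp
  have fm [measurable]: "f \<in> borel_measurable \<mu>"
    using f(1) measurable_cong_sets[OF \<mu>(1) refl] by blast
  have f_vimage: "f -` A \<in> sets \<mu>" if "A \<in> sets borel" for A
    using measurable_sets[OF fm that] by (simp add: space)
  define \<nu> where "\<nu> = distr (meas_restrict \<mu> J) borel f"
  have \<nu>: "emeasure \<nu> A = emeasure \<mu> (f -` A \<inter> J)" if "A \<in> sets borel" for A
  proof -
    have "emeasure \<nu> A = emeasure (meas_restrict \<mu> J) (f -` A \<inter> space (meas_restrict \<mu> J))"
      unfolding \<nu>_def using that by (intro emeasure_distr) (auto simp: meas_restrict_def)
    also have "space (meas_restrict \<mu> J) = UNIV" by (simp add: meas_restrict_def space)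
    also have "emeasure (meas_restrict \<mu> J) (f -` A \<inter> UNIV) = emeasure \<mu> (f -` A \<inter> J)"
      using f_vimage[OF that] J(1) by (simp add: emeasure_meas_restrict \<mu>(1))
    finally show ?thesis .
  qed
  have "absolutely_continuous \<mu> \<nu>"
    unfolding absolutely_continuous_def
  proof
    fix A assume A: "A \<in> null_sets \<mu>"
    then have Ab: "A \<in> sets borel" using \<mu>(1) by auto
    have "emeasure \<nu> A \<le> emeasure \<mu> (g -` A \<inter> {0..1})"
      unfolding \<nu>[OF Ab] using J by (intro emeasure_mono preserves_emeasure[OF g \<mu>(1) Ab]) auto
    also have "\<dots> = 0" using preserves_emeasure(2)[OF g \<mu>(1) Ab] A by auto
    finally show "A \<in> null_sets \<nu>" using Ab by (auto simp: \<nu>_def)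
  qed
  moreover have "sets \<nu> = sets \<mu>" by (simp add: \<nu>_def \<mu>(1))
  ultimately obtain h where h [measurable]: "h \<in> borel_measurable \<mu>" and dens: "density \<mu> h = \<nu>"
    using Radon_Nikodym by blast
  have \<nu>_h: "emeasure \<nu> A = (\<integral>\<^sup>+x. h x * indicator A x \<partial>\<mu>)" if "A \<in> sets borel" for A
    unfolding dens[symmetric] using that \<mu>(1) by (intro emeasure_density h) auto
  define Z where "Z = {x. h x = 0}"
  have "Z = h -` {0} \<inter> space \<mu>" by (auto simp: Z_def space)
  then have Z: "Z \<in> sets borel" using h \<mu>(1) by auto
  define E where "E = f ` J - Z"
  have E: "E \<in> sets borel" using J(2) Z by (auto simp: E_def)
  \<comment> \<open>By injectivity only points of \<open>J\<close> are mapped into \<open>E\<close>,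
    so on \<open>E\<close> the full image of \<mu> coincides with \<nu>.\<close>
  have f_E: "f -` (A \<inter> E) \<inter> J = f -` (A \<inter> E)" for A
    using \<open>inj f\<close> by (auto simp: E_def inj_def)
  have null_iff: "emeasure (meas_restrict (distr \<mu> borel f) E) A = 0 \<longleftrightarrow>
      emeasure (meas_restrict \<mu> E) A = 0" if A: "A \<in> sets borel" for A
  proof -
    have AE: "A \<inter> E \<in> sets borel" using A E by blast
    have "emeasure (meas_restrict (distr \<mu> borel f) E) A = emeasure (distr \<mu> borel f) (A \<inter> E)"
      using A E by (simp add: emeasure_meas_restrict)
    also have "\<dots> = emeasure \<nu> (A \<inter> E)"
      by (simp only: emeasure_distr[OF fm AE] \<nu>[OF AE] f_E space Int_UNIV_right)
    also have "\<dots> = (\<integral>\<^sup>+x. h x * indicator (A \<inter> E) x \<partial>\<mu>)" by (rule \<nu>_h[OF AE])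
    finally have "emeasure (meas_restrict (distr \<mu> borel f) E) A = 0 \<longleftrightarrow>
        (AE x in \<mu>. h x * indicator (A \<inter> E) x = 0)"
      using AE \<mu>(1) by (simp add: nn_integral_0_iff_AE)
    also have "\<dots> \<longleftrightarrow> (AE x in \<mu>. x \<notin> A \<inter> E)"
      by (intro AE_cong) (auto simp: E_def Z_def indicator_def)
    also have "\<dots> \<longleftrightarrow> emeasure \<mu> (A \<inter> E) = 0"
      using AE \<mu>(1) by (subst AE_iff_null_sets[symmetric]) auto
    also have "\<dots> \<longleftrightarrow> emeasure (meas_restrict \<mu> E) A = 0"
      using A E \<mu>(1) by (simp add: emeasure_meas_restrict)
    finally show ?thesis .
  qed
  have "equiv_measures (meas_restrict (distr \<mu> borel f) E) (meas_restrict \<mu> E)"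
    unfolding equiv_measures_def absolutely_continuous_def
    using null_iff by (auto simp: null_sets_def meas_restrict_def \<mu>(1))
  moreover have "AE x in \<mu>. x \<in> J \<longrightarrow> f x \<in> E"
  proof -
    \<comment> \<open>\<nu> gives no mass to the zeros of its own density, so almost no point of
      \<open>J\<close> is mapped outside \<open>E\<close>.\<close>
    have "emeasure \<nu> Z = 0"
      unfolding \<nu>_h[OF Z] using Z \<mu>(1) by (subst nn_integral_0_iff_AE) (auto simp: Z_def indicator_def)
    then have "f -` Z \<inter> J \<in> null_sets \<mu>"
      using \<nu>[OF Z] f_vimage[OF Z] J(1) \<mu>(1) by auto
    then have "AE x in \<mu>. x \<notin> f -` Z \<inter> J" by (rule AE_not_in)
    then show ?thesis by eventually_elim (auto simp: E_def)
  qed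
  ultimately show thesis using E that by blast
qed

text \<open>Around a point of nonzero derivative \<open>g\<close> agrees with a global
  diffeomorphism, to which the rigidity hypothesis applies through
  \<open>transported_equivalence\<close>. Lindelof's theorem leaves countably many exceptional null
  sets.\<close>

lemma AE_deriv_of_preserving_map:
  assumes \<mu>: "sets \<mu> = sets borel" "finite_measure \<mu>" and g: "preserves g \<mu>"
    and rigid: "\<And>f E. f \<in> diffR \<Longrightarrow> E \<in> sets borel \<Longrightarrow>
           equiv_measures (meas_restrict (distr \<mu> borel f) E) (meas_restrict \<mu> E) \<Longrightarrow>
           (AE x in \<mu>. x \<in> f -` E \<longrightarrow> deriv f x \<in> \<Lambda>)"
    and an: "real_analytic_on g S" and S: "open S" "S \<subseteq> {0..1}"
  shows "AE x in \<mu>. x \<in> S \<longrightarrow> deriv g x \<in> insert 0 \<Lambda>"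
proof -
  define \<F> where "\<F> = {B. open B \<and> (AE x in \<mu>. x \<in> B \<longrightarrow> deriv g x \<in> \<Lambda>)}"
  have cover: "\<exists>B\<in>\<F>. x \<in> B" if x: "x \<in> S" "deriv g x \<noteq> 0" for x
  proof -
    obtain f e where f: "f \<in> diffR" and e: "e > 0" "ball x e \<subseteq> S"
      and fg: "\<And>y. y \<in> ball x e \<Longrightarrow> f y = g y"
      using local_diffR_extension[OF real_analytic_on_has_derivative[OF an S(1)]
          real_analytic_on_continuous_on[OF real_analytic_on_deriv[OF an S(1)] S(1)] S(1) x] by metis
    have f': "bij f" "continuous_on UNIV f" "continuous_on UNIV (inv f)"
      using f by (auto simp: diffR_def intro: C1_differentiable_imp_continuous_on)
    \<comment> \<open>The image of the ball is a preimage under the continuous inverse, hence open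
      and in particular Borel.\<close>
    have "f ` ball x e = inv f -` ball x e" using f'(1) by (metis bij_imp_bij_inv bij_vimage_eq_inv_image inv_inv_eq)
    then have "f ` ball x e \<in> sets borel"
      using f'(3) open_vimage[of "ball x e" "inv f"] by (auto simp: continuous_on_eq_continuous_at)
    then obtain E where E: "E \<in> sets borel"
        "equiv_measures (meas_restrict (distr \<mu> borel f) E) (meas_restrict \<mu> E)"
        "AE x' in \<mu>. x' \<in> ball x e \<longrightarrow> f x' \<in> E"
      using transported_equivalence[OF \<mu> g, of f "ball x e"] f' e S fg
      by (auto simp: bij_def intro: borel_measurable_continuous_onI)
    have "AE y in \<mu>. y \<in> ball x e \<longrightarrow> deriv g y \<in> \<Lambda>"
      using E(3) rigid[OF f E(1,2)]
    proof eventually_elim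
      case (elim y)
      have "deriv f y = deriv g y" if "y \<in> ball x e"
        using fg that by (intro deriv_cong_ev) (auto simp: eventually_nhds intro!: exI[of _ "ball x e"])
      with elim show ?case by auto
    qed
    then have "ball x e \<in> \<F>" by (simp add: \<F>_def)
    with \<open>e > 0\<close> show ?thesis by (intro bexI[of _ "ball x e"]) auto
  qed
  obtain \<F>' where \<F>': "\<F>' \<subseteq> \<F>" "countable \<F>'" "\<Union>\<F>' = \<Union>\<F>"
    using Lindelof[of \<F>] by (auto simp: \<F>_def)
  have "AE x in \<mu>. \<forall>B\<in>\<F>'. x \<in> B \<longrightarrow> deriv g x \<in> \<Lambda>"
    using \<F>'(1) by (subst AE_ball_countable[OF \<F>'(2)]) (auto simp: \<F>_def)
  then show ?thesis
  proof eventually_elim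
    case (elim x)
    show ?case using cover[of x] elim \<F>'(3) by (metis UnionE UnionI insertCI)
  qed
qed

text \<open>Almost every point of \<open>S\<close> lies in a level set of the derivative for one of
  countably many values. Without atoms these level sets cannot all be countable, and an uncountable
  one forces \<open>g\<close> to be affine.\<close>

lemma affine_of_preserving_map:
  assumes \<mu>: "sets \<mu> = sets borel" "finite_measure \<mu>" and g: "preserves g \<mu>"
    and rigid: "\<And>f E. f \<in> diffR \<Longrightarrow> E \<in> sets borel \<Longrightarrow>
           equiv_measures (meas_restrict (distr \<mu> borel f) E) (meas_restrict \<mu> E) \<Longrightarrow>
           (AE x in \<mu>. x \<in> f -` E \<longrightarrow> deriv f x \<in> \<Lambda>)"
    and atomless: "\<And>x. emeasure \<mu> {x} = 0" and "countable \<Lambda>"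
    and an: "real_analytic_on g S" and S: "open S" "connected S" "S \<subseteq> {0..1}" "emeasure \<mu> S \<noteq> 0"
  shows "\<exists>u\<in>\<Lambda>. \<exists>v. \<forall>x\<in>S. g x = u * x + v"
proof (rule ccontr)
  assume not_affine: "\<not> ?thesis"
  have ctbl: "countable {x\<in>S. deriv g x = s}" if "s \<in> insert 0 \<Lambda>" for s
  proof (rule ccontr)
    assume "uncountable {x\<in>S. deriv g x = s}"
    then obtain v where v: "\<And>x. x \<in> S \<Longrightarrow> g x = s * x + v"
      using real_analytic_on_affine[OF an S(1,2)] by metis
    with not_affine have "s \<notin> \<Lambda>" by blast
    \<comment> \<open>Only \<open>s = 0\<close> is left; then \<open>g\<close> is constant and
      carries the positive mass of \<open>S\<close> to a single point.\<close>
    with that v have "\<And>x. x \<in> S \<Longrightarrow> g x = v" by simp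
    then have "emeasure \<mu> S \<le> emeasure \<mu> (g -` {v} \<inter> {0..1})"
      using S(3) preserves_emeasure(1)[OF g \<mu>(1), of "{v}"] by (intro emeasure_mono) auto
    also have "\<dots> = 0" using preserves_emeasure(2)[OF g \<mu>(1), of "{v}"] atomless by simp
    finally show False using S(4) by simp
  qed
  \<comment> \<open>If all level sets are countable, \<open>C\<close> is null, although it contains
    almost every point of \<open>S\<close>.\<close>
  define C where "C = (\<Union>s\<in>insert 0 \<Lambda>. {x\<in>S. deriv g x = s})"
  have "countable C" unfolding C_def using \<open>countable \<Lambda>\<close> ctbl by (intro countable_UN) auto
  then have "(\<Union>x\<in>C. {x}) \<in> null_sets \<mu>"
    by (rule null_sets_UN') (auto simp: null_sets_def atomless \<mu>(1))
  then have "AE x in \<mu>. x \<notin> C" using AE_not_in by fastforce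
  moreover have "AE x in \<mu>. x \<in> S \<longrightarrow> deriv g x \<in> insert 0 \<Lambda>"
    by (rule AE_deriv_of_preserving_map[OF \<mu> g _ an S(1,3)]) (rule rigid)
  ultimately have "AE x in \<mu>. x \<notin> S" by eventually_elim (auto simp: C_def)
  then have "emeasure \<mu> S = 0"
    using S(1) \<mu>(1) by (subst (asm) AE_iff_null_sets[symmetric]) auto
  with S(4) show False ..
qed

text \<open>At an atom of mass \<open>m\<close> the measure of a ball stays between \<open>m\<close>
  and 1 while \<open>ln r\<close> tends to minus infinity, so the local dimension is 0 there; and an
  atom avoids every null exceptional set.\<close>

lemma intermediate_dimension_atomless:
  assumes "sets \<mu> = sets borel" "prob_space \<mu>" "intermediate_dimension \<mu>"
  shows "emeasure \<mu> {x} = 0"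
proof (rule ccontr)
  assume nz: "emeasure \<mu> {x} \<noteq> 0"
  interpret prob_space \<mu> by fact
  define m where "m = measure \<mu> {x}"
  have m: "m > 0" using nz by (simp add: m_def emeasure_eq_measure zero_less_measure_iff)
  obtain N where N: "{x \<in> space \<mu>. \<not> (\<exists>D. has_local_dimension \<mu> x D \<and> 0 < D \<and> D < 1)} \<subseteq> N"
      "emeasure \<mu> N = 0" "N \<in> sets \<mu>"
    using AE_E assms(3) unfolding intermediate_dimension_def by blast
  have "x \<notin> N"
  proof
    assume "x \<in> N"
    then have "emeasure \<mu> {x} \<le> emeasure \<mu> N" using N by (intro emeasure_mono) auto
    with nz N show False by simp
  qed
  with N(1) sets_eq_imp_space_eq[OF assms(1)]
  obtain D where D: "((\<lambda>r. ln (measure \<mu> (ball x r)) / ln r) \<longlongrightarrow> D) (at_right 0)" "0 < D"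
    by (auto simp: has_local_dimension_def)
  have "((\<lambda>r. ln m / ln r) \<longlongrightarrow> 0) (at_right 0)"
    by (intro tendsto_divide_0[OF tendsto_const] filterlim_at_bot_imp_at_infinity ln_at_0)
  \<comment> \<open>For \<open>r < 1\<close> both logarithms are at most 0, so the quotient is
    nonnegative and equals its norm.\<close>
  moreover have "\<forall>\<^sub>F r in at_right 0. norm (ln (measure \<mu> (ball x r)) / ln r) \<le> ln m / ln r"
    using eventually_at_right_less[of 0] eventually_at_right_real[of 0 "1::real", simplified]
  proof eventually_elim
    case (elim r)
    have "m \<le> measure \<mu> (ball x r)"
      unfolding m_def using elim assms(1) by (intro finite_measure_mono) auto
    with m have "ln m \<le> ln (measure \<mu> (ball x r))" "ln (measure \<mu> (ball x r)) \<le> 0" by auto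
    moreover have "ln r < 0" using elim by auto
    ultimately show ?case by (auto simp: abs_divide divide_simps)
  qed
  ultimately have "((\<lambda>r. ln (measure \<mu> (ball x r)) / ln r) \<longlongrightarrow> 0) (at_right 0)"
    by (rule Lim_null_comparison[rotated])
  from tendsto_unique[OF _ D(1) this] D(2) show False by simp
qed

section \<open>Piecewise linear functions with prescribed slopes\<close>

lemma countable_slopes: "countable (slopes a n)"
proof -
  have "slopes a n = (\<lambda>(\<epsilon>, k). \<epsilon> * real a powr (real_of_int k / real n)) ` ({1, -1} \<times> UNIV)"
    by (auto simp: slopes_def)
  then show ?thesis by simp
qed

lemma one_in_slopes: "a > 0 \<Longrightarrow> 1 \<in> slopes a n"
  unfolding slopes_def by (rule CollectI, rule exI[of _ 1], rule exI[of _ 0]) simp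

text \<open>Disjointness is restored by cutting: \<open>J\<close> becomes a piece, and every old
  piece keeps only its parts to the left and to the right of \<open>J\<close>, which are again
  intervals.\<close>

lemma piecewise_linear_Un_interval:
  assumes U: "piecewise_linear_with_slopes g U \<Lambda>" and J: "is_interval J"
    and lin: "\<exists>u\<in>\<Lambda>. \<exists>v. \<forall>x\<in>J. g x = u * x + v"
  shows "piecewise_linear_with_slopes g (U \<union> J) \<Lambda>"
\<comment> \<open>An empty \<open>J\<close> adds nothing, and only a nonempty one separates
  \<open>L\<close> from \<open>R\<close>.\<close>
proof (cases "J = {}")
  case False
  then obtain j where j: "j \<in> J" by blast
  obtain P where P: "finite P" "partition_on U P" "\<And>I. I \<in> P \<Longrightarrow> is_interval I"
    and P_lin: "\<And>I. I \<in> P \<Longrightarrow> \<exists>u\<in>\<Lambda>. \<exists>v. \<forall>x\<in>I. g x = u * x + v"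
    using U by (auto simp: piecewise_linear_with_slopes_def interval_division_def)
  define L where "L = {x. \<forall>y\<in>J. x < y}"
  define R where "R = {x. \<forall>y\<in>J. y < x}"
  define Q where "Q = insert J ((\<lambda>I. I \<inter> L) ` P \<union> (\<lambda>I. I \<inter> R) ` P) - {{}}"
  have LR: "is_interval L" "is_interval R"
    by (auto simp: L_def R_def is_interval_1)
  have disj: "L \<inter> R = {}" "L \<inter> J = {}" "R \<inter> J = {}"
    using j by (force simp: L_def R_def)+
  have cover: "L \<union> R \<union> J = UNIV"
  proof -
    have "x \<in> J" if "x \<notin> L" "x \<notin> R" for x
    proof -
      from that obtain y z where "y \<in> J" "y \<le> x" "z \<in> J" "x \<le> z"
        by (auto simp: L_def R_def not_less)
      with J show ?thesis unfolding is_interval_1 by blast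
    qed
    then show ?thesis by blast
  qed
  have "finite Q" using P(1) by (simp add: Q_def)
  moreover have "partition_on (U \<union> J) Q"
  proof (rule partition_onI)
    have "\<Union>Q = J \<union> (\<Union>P \<inter> L) \<union> (\<Union>P \<inter> R)" by (auto simp: Q_def)
    then show "\<Union>Q = U \<union> J"
      using cover partition_onD1[OF P(2)] by blast
    have same: "I = I'" if "I \<in> P" "I' \<in> P" "t \<in> I" "t \<in> I'" for I I' t
      using disjointD[OF partition_onD2[OF P(2)] that(1,2)] that(3,4) by blast
    fix X Y assume XY: "X \<in> Q" "Y \<in> Q" "X \<noteq> Y"
    have Q_cases: "Z = J \<or> (\<exists>I\<in>P. Z = I \<inter> L) \<or> (\<exists>I\<in>P. Z = I \<inter> R)" if "Z \<in> Q" for Z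
      using that by (auto simp: Q_def)
    have False if "t \<in> X" "t \<in> Y" for t
      using Q_cases[OF XY(1)] Q_cases[OF XY(2)]
    proof (elim disjE bexE)
      fix I I' assume "I \<in> P" "I' \<in> P" "X = I \<inter> L" "Y = I' \<inter> L"
      with that same XY(3) show False by blast
    next
      fix I I' assume "I \<in> P" "I' \<in> P" "X = I \<inter> R" "Y = I' \<inter> R"
      with that same XY(3) show False by blast
    qed (use that disj XY(3) in blast)+
    then show "disjnt X Y" by (auto simp: disjnt_def)
  qed (auto simp: Q_def)
  moreover have "is_interval X" if "X \<in> Q" for X
    using that P(3) LR J by (auto simp: Q_def is_interval_Int)
  moreover have "\<exists>u\<in>\<Lambda>. \<exists>v. \<forall>x\<in>X. g x = u * x + v" if "X \<in> Q" for X
  proof -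
    from that consider "X = J" | I where "I \<in> P" "X \<subseteq> I" by (auto simp: Q_def)
    then show ?thesis
    proof cases
      case 2
      with P_lin[of I] show ?thesis by blast
    qed (use lin in simp)
  qed
  ultimately show ?thesis
    unfolding piecewise_linear_with_slopes_def interval_division_def by blast
qed (use U in simp)

text \<open>Overlaps are allowed, since adding the intervals one at a time recuts the earlier
  pieces.\<close>

lemma piecewise_linear_Union_intervals:
  assumes "finite \<J>" "\<And>J. J \<in> \<J> \<Longrightarrow> is_interval J"
    and "\<And>J. J \<in> \<J> \<Longrightarrow> \<exists>u\<in>\<Lambda>. \<exists>v. \<forall>x\<in>J. g x = u * x + v"
  shows "piecewise_linear_with_slopes g (\<Union>\<J>) \<Lambda>"
  using assms
proof (induction \<J> rule: finite_induct)
  case empty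
  show ?case
    by (auto simp: piecewise_linear_with_slopes_def interval_division_def partition_on_empty)
next
  case (insert J \<J>)
  then have "piecewise_linear_with_slopes g (\<Union>\<J> \<union> J) \<Lambda>"
    by (intro piecewise_linear_Un_interval) auto
  then show ?case by (simp add: Un_commute)
qed

section \<open>Finite families of intervals\<close>

lemma closure_UN_finite:
  "finite A \<Longrightarrow> closure (\<Union>i\<in>A. S i) = (\<Union>i\<in>A. closure (S i))"
  by (induction A rule: finite_induct) (auto simp: closure_Un)

text \<open>Closure commutes with finite unions, so \<open>x\<close> is approached from the right
  within a single piece; being an interval, that piece contains everything strictly between
  \<open>x\<close> and any of its points to the right of \<open>x\<close>.\<close>

lemma finite_interval_cover_right:
  fixes x :: real
  assumes "finite P" "\<And>I. I \<in> P \<Longrightarrow> is_interval I" "{x<..<b} \<subseteq> \<Union>P" "x < b"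
  obtains I y where "I \<in> P" "y > x" "{x<..<y} \<subseteq> I"
proof -
  have "x \<in> closure {x<..<b}" using assms(4) by simp
  also have "{x<..<b} \<subseteq> (\<Union>I\<in>P. I \<inter> {x<..})" using assms(3) by auto
  then have "closure {x<..<b} \<subseteq> (\<Union>I\<in>P. closure (I \<inter> {x<..}))"
    using closure_mono closure_UN_finite[OF assms(1)] by metis
  finally obtain I where I: "I \<in> P" "x \<in> closure (I \<inter> {x<..})" by blast
  then have "I \<inter> {x<..} \<noteq> {}" by auto
  then obtain y where y: "y \<in> I" "y > x" by blast
  have "{x<..<y} \<subseteq> I"
  proof
    fix t assume t: "t \<in> {x<..<y}"
    then obtain z where "z \<in> I" "z > x" "dist z x < t - x"
      using I(2)[unfolded closure_approachable, rule_format, of "t - x"] by auto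
    then have "z \<le> t" by (simp add: dist_real_def)
    moreover have "t \<le> y" using t by simp
    ultimately show "t \<in> I"
      using \<open>z \<in> I\<close> y(1) assms(2)[OF I(1)] unfolding is_interval_1 by blast
  qed
  with I y show thesis using that by blast
qed

text \<open>The mirror image of the right-hand version under \<open>uminus\<close>.\<close>

lemma finite_interval_cover_left:
  fixes x :: real
  assumes "finite P" "\<And>I. I \<in> P \<Longrightarrow> is_interval I" "{b<..<x} \<subseteq> \<Union>P" "b < x"
  obtains I y where "I \<in> P" "y < x" "{y<..<x} \<subseteq> I"
proof -
  have "{- x<..<- b} \<subseteq> \<Union>((`) uminus ` P)"
  proof
    fix t assume "t \<in> {- x<..<- b}"
    then have "- t \<in> {b<..<x}" by auto
    then obtain I where "I \<in> P" "- t \<in> I" using assms(3) by blast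
    then show "t \<in> \<Union>((`) uminus ` P)" by (auto intro!: bexI[of _ I] image_eqI[of t uminus "- t"])
  qed
  then obtain J y where J: "J \<in> (`) uminus ` P" "y > - x" "{- x<..<y} \<subseteq> J"
    using assms by (elim finite_interval_cover_right[rotated 2]) auto
  then obtain I where "I \<in> P" "J = uminus ` I" by blast
  moreover have "{- y<..<x} \<subseteq> I"
  proof
    fix t assume "t \<in> {- y<..<x}"
    then have "- t \<in> J" using J(3) by auto
    then show "t \<in> I" using \<open>J = uminus ` I\<close> by auto
  qed
  ultimately show thesis using J(2) by (intro that[of I "- y"]) auto
qed

text \<open>A point other than the infimum and the supremum has points of the interval on both sides
  and is therefore interior.\<close>

lemma finite_interval_minus_interior:
  fixes I :: "real set"
  assumes "is_interval I" "bounded I"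
  shows "finite (I - interior I)"
proof (rule finite_subset)
  show "I - interior I \<subseteq> {Inf I, Sup I}"
  proof
    fix x assume x: "x \<in> I - interior I"
    show "x \<in> {Inf I, Sup I}"
    proof (rule ccontr)
      assume "x \<notin> {Inf I, Sup I}"
      moreover have "Inf I \<le> x" "x \<le> Sup I"
        using x assms(2) bounded_imp_bdd_below bounded_imp_bdd_above
        by (auto intro: cInf_lower cSup_upper)
      ultimately have "Inf I < x" "x < Sup I" by auto
      moreover have "I \<noteq> {}" using x by auto
      ultimately have "\<exists>y\<in>I. y < x" "\<exists>z\<in>I. x < z"
        using cInf_lessD[of I x] less_cSupD[of I x] by simp_all
      then obtain y z where yz: "y \<in> I" "y < x" "z \<in> I" "x < z" by blast
      have "{y<..<z} \<subseteq> I"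
      proof
        fix t assume "t \<in> {y<..<z}"
        then have "y \<le> t" "t \<le> z" by auto
        with yz(1,3) assms(1) show "t \<in> I" unfolding is_interval_1 by blast
      qed
      moreover have "x \<in> {y<..<z}" using yz by simp
      ultimately have "x \<in> interior I" by (intro interiorI[of "{y<..<z}"]) auto
      with x show False by simp
    qed
  qed
qed simp

section \<open>The support of \<mu> and linearity of \<open>g\<close> around it\<close>

lemma disjoint_support: "open V \<Longrightarrow> emeasure \<mu> V = 0 \<Longrightarrow> V \<inter> support \<mu> = {}"
  by (auto simp: support_def)

lemma emeasure_nonzero_of_mem_support:
  "x \<in> support \<mu> \<Longrightarrow> open V \<Longrightarrow> x \<in> V \<Longrightarrow> emeasure \<mu> V \<noteq> 0"
  by (auto simp: support_def)

text \<open>\<open>U\<close> is open relative to \<open>{0..1}\<close> because the values of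
  \<open>g\<close> outside carry no meaning, while 0 and 1 may belong to the support.\<close>

theorem corollary1p2:
  fixes a n :: nat and \<mu> :: "real measure" and g :: "real \<Rightarrow> real"
  assumes "a \<ge> 2"
    and "prob_on_unit_interval \<mu>"
    and "ergodic_for (times_map a) \<mu>"
    and "intermediate_dimension \<mu>"
    and "n \<ge> 1"
    and "\<And>f E. f \<in> diffR \<Longrightarrow> E \<in> sets borel \<Longrightarrow>
           equiv_measures (meas_restrict (distr \<mu> borel f) E) (meas_restrict \<mu> E) \<Longrightarrow>
           (AE x in \<mu>. x \<in> f -` E \<longrightarrow> deriv f x \<in> slopes a n)"
    and "g \<in> {0..1} \<rightarrow> {0..1}"
    and "piecewise_analytic_on g {0..1}"
    and "preserves g \<mu>"
  shows "\<exists>U. openin (top_of_set {0..1}) U \<and>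
             support \<mu> \<subseteq> U \<union> (break_points g \<inter> gap_endpoints (support \<mu>)) \<and>
             piecewise_linear_with_slopes g U (slopes a n)"
proof -
  have \<mu>: "sets \<mu> = sets borel" "prob_space \<mu>" "emeasure \<mu> {0..1} = 1"
    using assms(2) by (auto simp: prob_on_unit_interval_def)
  interpret prob_space \<mu> by fact
  have space: "space \<mu> = UNIV" using sets_eq_imp_space_eq[OF \<mu>(1)] by simp
  note atomless = intermediate_dimension_atomless[OF \<mu>(1,2) assms(4)]
  obtain P where P: "finite P" "\<Union>P = {0..1}" "\<And>I. I \<in> P \<Longrightarrow> is_interval I"
    and P_an: "\<And>I. I \<in> P \<Longrightarrow> real_analytic_on g I"
    using assms(8) by (auto simp: piecewise_analytic_on_def interval_division_def partition_on_def)
  have P_interior: "is_interval (interior I)" if "I \<in> P" for I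
    using P(3)[OF that] by (simp add: is_interval_convex_1 convex_interior)
  define aff where "aff W \<longleftrightarrow> (\<exists>u\<in>slopes a n. \<exists>v. \<forall>x\<in>W. g x = u * x + v)" for W
  have aff_mono: "aff V" if "aff W" "V \<subseteq> W" for V W using that unfolding aff_def by blast
  \<comment> \<open>On at most one point any slope will do; 1 is admissible as the power of
    \<open>a\<close> with exponent 0.\<close>
  have aff_single: "aff W" if "W \<subseteq> {x}" for W x
    using that one_in_slopes[of a n] assms(1) unfolding aff_def
    by (intro bexI[of _ 1] exI[of _ "g x - x"]) auto
  have aff: "aff W" if "real_analytic_on g W" "open W" "connected W" "W \<subseteq> {0..1}" "emeasure \<mu> W \<noteq> 0"
    for W
    unfolding aff_def
    by (rule affine_of_preserving_map[OF \<mu>(1) finite_measure_axioms assms(9) _ atomless countable_slopes that])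
      (rule assms(6))
  have outside: "emeasure \<mu> V = 0" if "V \<inter> {0..1} = {}" "V \<in> sets borel" for V
  proof -
    have "{0..1} \<in> sets \<mu>" using \<mu>(1) by simp
    moreover have "prob {0..1} = 1" using \<mu>(3) by (simp add: measure_def)
    ultimately have "AE x in \<mu>. x \<in> {0..1}" using AE_in_set_eq_1 by blast
    then have "AE x in \<mu>. x \<notin> V" by eventually_elim (use that(1) in blast)
    then show ?thesis using that(2) \<mu>(1) by (subst (asm) AE_iff_null_sets[symmetric]) auto
  qed
  have supp_unit: "support \<mu> \<subseteq> {0..1}"
    using disjoint_support[of "- {0..1}" \<mu>] outside[of "- {0..1}"] by auto
  have piece: "aff W \<or> emeasure \<mu> W = 0" if "W \<subseteq> I" "I \<in> P" "open W" "connected W" for W I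
    using aff[OF real_analytic_on_subset[OF P_an[OF that(2)] that(1)] that(3,4)] that(1,2) P(2) by blast
  \<comment> \<open>Each side of a point is classified separately: either it carries no mass near
    the point, or \<open>g\<close> is affine there with an admissible slope.\<close>
  define Rnull where "Rnull x \<longleftrightarrow> (\<exists>y>x. emeasure \<mu> {x<..<y} = 0)" for x
  define Lnull where "Lnull x \<longleftrightarrow> (\<exists>y<x. emeasure \<mu> {y<..<x} = 0)" for x
  define Raff where "Raff x \<longleftrightarrow> (\<exists>y>x. aff ({0..1} \<inter> {x<..<y}))" for x
  define Laff where "Laff x \<longleftrightarrow> (\<exists>y<x. aff ({0..1} \<inter> {y<..<x}))" for x
  have R: "Rnull x \<or> Raff x" if x: "x \<in> {0..<1}" for x
  proof -
    obtain I y where I: "I \<in> P" "y > x" "{x<..<y} \<subseteq> I"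
    proof (rule finite_interval_cover_right[OF P(1,3), of x 1])
      show "{x<..<1} \<subseteq> \<Union>P" "x < 1" unfolding P(2) using x by auto
    qed
    from piece[OF I(3,1)] have "aff {x<..<y} \<or> emeasure \<mu> {x<..<y} = 0" by simp
    with I(2) show ?thesis unfolding Rnull_def Raff_def using aff_mono[of _ "{0..1} \<inter> {x<..<y}"] by blast
  qed
  have L: "Lnull x \<or> Laff x" if x: "x \<in> {0<..1}" for x
  proof -
    obtain I y where I: "I \<in> P" "y < x" "{y<..<x} \<subseteq> I"
    proof (rule finite_interval_cover_left[OF P(1,3), of 0 x])
      show "{0<..<x} \<subseteq> \<Union>P" "0 < x" unfolding P(2) using x by auto
    qed
    from piece[OF I(3,1)] have "aff {y<..<x} \<or> emeasure \<mu> {y<..<x} = 0" by simp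
    with I(2) show ?thesis unfolding Lnull_def Laff_def using aff_mono[of _ "{0..1} \<inter> {y<..<x}"] by blast
  qed
  \<comment> \<open>Beyond an endpoint of \<open>{0..1}\<close> both alternatives hold, as the outer
    side is null and meets \<open>{0..1}\<close> in the empty set.\<close>
  have R1: "Rnull 1" "Raff 1"
    unfolding Rnull_def Raff_def
    by (intro exI[of _ 2] conjI outside aff_single[of _ 1]; auto)+
  have L0: "Lnull 0" "Laff 0"
    unfolding Lnull_def Laff_def
    by (intro exI[of _ "-1"] conjI outside aff_single[of _ 0]; auto)+
  \<comment> \<open>As points have measure 0, two null sides would give \<open>x\<close> a null
    neighbourhood.\<close>
  have not_both_null: "\<not> (Lnull x \<and> Rnull x)" if x: "x \<in> support \<mu>" for x
  proof
    assume "Lnull x \<and> Rnull x"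
    then obtain y z where yz: "y < x" "emeasure \<mu> {y<..<x} = 0" "x < z" "emeasure \<mu> {x<..<z} = 0"
      by (auto simp: Lnull_def Rnull_def)
    have "{y<..<x} \<union> {x} \<union> {x<..<z} \<in> null_sets \<mu>"
      using yz atomless \<mu>(1) by (intro null_sets.Un) (auto simp: null_sets_def)
    moreover have "{y<..<x} \<union> {x} \<union> {x<..<z} = {y<..<z}" using yz by auto
    ultimately have "emeasure \<mu> {y<..<z} = 0" by auto
    from disjoint_support[OF _ this] x yz(1,3) show False by auto
  qed
  \<comment> \<open>A null side makes \<open>x\<close> a gap endpoint, hence by \<open>good\<close>
    not a break point. Then \<open>g\<close> is analytic on a whole ball around \<open>x\<close>,
    which has positive measure, and the affine formula extends across the gap.\<close>
  have inner: "Laff x \<and> Raff x"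
    if x: "x \<in> support \<mu>" "0 < x" "x < 1" "Lnull x \<or> Rnull x"
      and good: "x \<notin> break_points g \<inter> gap_endpoints (support \<mu>)" for x
  proof -
    have "\<exists>e>0. {x - e<..<x} \<inter> support \<mu> = {} \<or> {x<..<x + e} \<inter> support \<mu> = {}"
      using x(4)
    proof
      assume "Lnull x"
      then obtain y where "y < x" "{y<..<x} \<inter> support \<mu> = {}"
        using disjoint_support[OF open_greaterThanLessThan] by (auto simp only: Lnull_def)
      then show ?thesis by (intro exI[of _ "x - y"]) auto
    next
      assume "Rnull x"
      then obtain y where "y > x" "{x<..<y} \<inter> support \<mu> = {}"
        using disjoint_support[OF open_greaterThanLessThan] by (auto simp only: Rnull_def)
      then show ?thesis by (intro exI[of _ "y - x"]) auto
    qed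
    with x(1) have "x \<in> gap_endpoints (support \<mu>)" by (auto simp: gap_endpoints_def)
    with good x(2,3) obtain e where e: "e > 0" "real_analytic_on g ({0..1} \<inter> ball x e)"
      by (auto simp: break_points_def)
    \<comment> \<open>This radius keeps the ball inside both \<open>{0..1}\<close> and the ball of
      analyticity.\<close>
    define d where "d = min e (min x (1 - x))"
    have d: "d > 0" "ball x d \<subseteq> {0..1} \<inter> ball x e"
      using e(1) x(2,3) by (auto simp: d_def dist_real_def)
    have "emeasure \<mu> (ball x d) \<noteq> 0"
      using d(1) by (intro emeasure_nonzero_of_mem_support[OF x(1)]) auto
    then have "aff (ball x d)"
      using d(2) by (intro aff real_analytic_on_subset[OF e(2)]) auto
    then have "aff ({0..1} \<inter> {x - d<..<x})" "aff ({0..1} \<inter> {x<..<x + d})"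
      by (rule aff_mono; auto simp: dist_real_def)+
    with d(1) show ?thesis unfolding Laff_def Raff_def
      by (intro conjI exI[of _ "x - d"] exI[of _ "x + d"]) auto
  qed
  define B where "B = break_points g \<inter> gap_endpoints (support \<mu>)"
  \<comment> \<open>At 0 and 1 the outer side is null, so the inner one is not and must be affine.
    At other points either neither side is null, or \<open>inner\<close> applies.\<close>
  have sides: "Laff x \<and> Raff x" if x: "x \<in> support \<mu> - B" for x
  proof -
    have "x \<in> {0..1}" using x supp_unit by auto
    then consider "x = 0" | "x = 1" | "0 < x" "x < 1" by fastforce
    then show ?thesis
    proof cases
      case 1 with not_both_null[of x] x R[of x] L0 show ?thesis by auto
    next
      case 2 with not_both_null[of x] x L[of x] R1 show ?thesis by auto
    next
      case 3 with inner[of x] x R[of x] L[of x] show ?thesis by (auto simp: B_def)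
    qed
  qed
  \<comment> \<open>\<open>F\<close> holds the support points outside \<open>B\<close> at which a
    piece ends; they need neighbourhoods of their own, and each piece contributes at most
    two.\<close>
  define F where "F = (\<Union>I\<in>P. I - interior I) \<inter> (support \<mu> - B)"
  have "finite (I - interior I)" if "I \<in> P" for I
  proof (rule finite_interval_minus_interior[OF P(3)[OF that]])
    have "I \<subseteq> {0..1}" using that P(2) by blast
    then show "bounded I" by (rule bounded_subset[OF bounded_closed_interval])
  qed
  then have "finite F" using P(1) by (auto simp: F_def)
  have "\<forall>x\<in>F. \<exists>e>0. aff ({0..1} \<inter> {x - e<..<x}) \<and> aff ({0..1} \<inter> {x<..<x + e})"
  proof
    fix x assume "x \<in> F"
    with sides[of x] obtain y z where yz: "y < x" "aff ({0..1} \<inter> {y<..<x})" "x < z" "aff ({0..1} \<inter> {x<..<z})"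
      by (auto simp: F_def Laff_def Raff_def)
    then show "\<exists>e>0. aff ({0..1} \<inter> {x - e<..<x}) \<and> aff ({0..1} \<inter> {x<..<x + e})"
      by (intro exI[of _ "min (x - y) (z - x)"] conjI aff_mono[OF yz(2)] aff_mono[OF yz(4)]) auto
  qed
  then obtain e where e: "\<And>x. x \<in> F \<Longrightarrow> e x > 0"
      "\<And>x. x \<in> F \<Longrightarrow> aff ({0..1} \<inter> {x - e x<..<x})" "\<And>x. x \<in> F \<Longrightarrow> aff ({0..1} \<inter> {x<..<x + e x})"
    by metis
  define \<I> where "\<I> = {W \<in> interior ` P. aff W}"
  \<comment> \<open>The affine formulas on the two sides of a point of \<open>F\<close> may differ,
    and \<open>g\<close> may jump there, so the point forms an interval by itself.\<close>
  define \<J> where "\<J> = \<I> \<union> (\<Union>x\<in>F. {{0..1} \<inter> {x - e x<..<x}, {x}, {0..1} \<inter> {x<..<x + e x}})"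
  have ball: "{0..1} \<inter> ball x (e x) = ({0..1} \<inter> {x - e x<..<x}) \<union> {x} \<union> ({0..1} \<inter> {x<..<x + e x})"
    if "x \<in> F" for x
    using that supp_unit e(1)[OF that] by (auto simp: F_def dist_real_def)
  \<comment> \<open>Around each point of \<open>F\<close> the three intervals reassemble into a
    relative ball, which makes the union relatively open.\<close>
  have "\<Union>\<J> = \<Union>\<I> \<union> (\<Union>x\<in>F. ({0..1} \<inter> {x - e x<..<x}) \<union> {x} \<union> ({0..1} \<inter> {x<..<x + e x}))"
    by (auto simp: \<J>_def)
  also have "\<dots> = \<Union>\<I> \<union> (\<Union>x\<in>F. {0..1} \<inter> ball x (e x))" using ball by simp
  finally have U: "\<Union>\<J> = \<Union>\<I> \<union> (\<Union>x\<in>F. {0..1} \<inter> ball x (e x))" .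
  have "\<Union>\<I> \<subseteq> {0..1}" using P(2) interior_subset by (fastforce simp: \<I>_def)
  then have "\<Union>\<J> = {0..1} \<inter> (\<Union>\<I> \<union> (\<Union>x\<in>F. ball x (e x)))" unfolding U by blast
  moreover have "open (\<Union>\<I> \<union> (\<Union>x\<in>F. ball x (e x)))" by (intro open_Un open_Union open_UN) (auto simp: \<I>_def)
  ultimately have "openin (top_of_set {0..1}) (\<Union>\<J>)" by (auto simp: openin_open)
  moreover have "support \<mu> \<subseteq> \<Union>\<J> \<union> B"
  proof
    fix x assume x: "x \<in> support \<mu>"
    with supp_unit P(2) obtain I where I: "I \<in> P" "x \<in> I" by blast
    show "x \<in> \<Union>\<J> \<union> B"
    proof (cases "x \<in> interior I")
      case True
      \<comment> \<open>A piece whose interior meets the support has positive measure, so the null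
        alternative of \<open>piece\<close> is excluded.\<close>
      have "emeasure \<mu> (interior I) \<noteq> 0"
        using True by (intro emeasure_nonzero_of_mem_support[OF x]) auto
      then have "aff (interior I)"
        using piece[OF interior_subset I(1) open_interior is_interval_connected] P_interior[OF I(1)]
        by blast
      with True I show ?thesis by (auto simp: \<J>_def \<I>_def)
    next
      case False
      show ?thesis
      proof (cases "x \<in> B")
        case False
        with x I \<open>x \<notin> interior I\<close> have "x \<in> F" by (auto simp: F_def)
        then show ?thesis by (auto simp: \<J>_def)
      qed simp
    qed
  qed
  moreover have "piecewise_linear_with_slopes g (\<Union>\<J>) (slopes a n)"
  proof (rule piecewise_linear_Union_intervals)
    show "finite \<J>" using P(1) \<open>finite F\<close> by (auto simp: \<J>_def \<I>_def)
    show "is_interval W" if "W \<in> \<J>" for W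
      using that P_interior
      by (auto simp: \<J>_def \<I>_def is_interval_convex_1 intro!: convex_Int)
    have "aff W" if "W \<in> \<J>" for W
      using that e(2,3) aff_single by (auto simp: \<J>_def \<I>_def)
    then show "\<exists>u\<in>slopes a n. \<exists>v. \<forall>x\<in>W. g x = u * x + v" if "W \<in> \<J>" for W
      using that by (simp add: aff_def)
  qed
  ultimately show ?thesis unfolding B_def by blast
qed

end
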